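(* The first order discrete initial value problem $$\triangle f(n) = n \quad (n \in \mathbb{N}), \qquad f(1) = 1,$$ for an unknown real-valued sequence $f:\mathbb{N}\to\mathbb{R}$, has solution given by $$f(n) = 1 + \frac{n^{2}-n}{2} \quad (n\in\mathbb{N}).$$
   Context: Here $\mathbb{N}=\{1,2,3,\dots\}$. For a real-valued sequence $f$, the first order difference is defined by $\triangle f(n) := f(n+1)-f(n)$. *)

theory Defs
  imports Complex_Main
begin

(* Sequences indexed by {1,2,3,...} are functions on nat; the value at 0 is a junk value,
   so every statement about them is to be guarded by n \<ge> 1. *)

definition forward_diff :: "(nat \<Rightarrow> real) \<Rightarrow> nat \<Rightarrow> real"  ("\<triangle>") where
  "\<triangle> f n = f (n + 1) - f n"

end

theory Submission
  imports Defs
begin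

text \<open>
  The sequence \<open>(n\<^sup>2 - n) / 2\<close> is the triangular number \<open>1 + \<dots> + (n - 1)\<close>: it vanishes at
  \<open>1\<close> and its first difference is \<open>n\<close>, so adding the initial value \<open>1\<close> gives a solution.
  Uniqueness holds because a first difference together with one value determines all later
  values; the value at \<open>0\<close> is constrained by neither side, hence the induction starts at \<open>1\<close>.
\<close>

theorem proposition1:
  fixes f :: "nat \<Rightarrow> real"
  shows "((\<forall>n\<ge>1. \<triangle> f n = real n) \<and> f 1 = 1) \<longleftrightarrow>
         (\<forall>n\<ge>1. f n = 1 + ((real n)\<^sup>2 - real n) / 2)"
proof
  assume ivp: "(\<forall>n\<ge>1. \<triangle> f n = real n) \<and> f 1 = 1"
  show "\<forall>n\<ge>1. f n = 1 + ((real n)\<^sup>2 - real n) / 2"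
  proof (intro allI impI)
    fix n :: nat
    assume "n \<ge> 1"
    then show "f n = 1 + ((real n)\<^sup>2 - real n) / 2"
    proof (induction n rule: dec_induct)
      case base
      show ?case using ivp by simp
    next
      case (step n)
      have "f (Suc n) = f n + real n"
        using ivp step.hyps by (auto simp: forward_diff_def algebra_simps)
      then show ?case
        using step.IH by (simp add: power2_eq_square field_simps)
    qed
  qed
next
  assume closed: "\<forall>n\<ge>1. f n = 1 + ((real n)\<^sup>2 - real n) / 2"
  have "\<triangle> f n = real n" if "n \<ge> 1" for n
  proof -
    have "f (n + 1) = 1 + ((real n + 1)\<^sup>2 - (real n + 1)) / 2"
      using closed[rule_format, of "n + 1"] by (simp add: add.commute)
    moreover have "f n = 1 + ((real n)\<^sup>2 - real n) / 2"
      using closed that by blast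
    ultimately show ?thesis
      by (simp add: forward_diff_def power2_eq_square field_simps)
  qed
  moreover have "f 1 = 1"
    using closed by simp
  ultimately show "(\<forall>n\<ge>1. \<triangle> f n = real n) \<and> f 1 = 1"
    by blast
qed

end
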